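(* Let $(s_t,a_t,r_t,s_{t+1})$ be a fixed transition, and let the critic distribution $Z_\theta(s_t,a_t)$ be Gaussian with mean $Q_{\theta_1}(s_t,a_t)\in\mathbb R$ and standard deviation $\sigma_{\theta_2}(s_t,a_t)>0$. Let the (Gaussian) empirical soft distributional Bellman target $\hat{\mathcal T}_H^{\pi}Z(s_t,a_t)$ be fixed, i.e. not depending on $\theta=(\theta_1,\theta_2)$. Define the gradient weight $$\Psi_\theta(s_t,a_t):=\frac{\partial}{\partial Q_{\theta_1}(s_t,a_t)}\, d_e\big(\hat{\mathcal T}_H^{\pi}Z(s_t,a_t),\,Z_\theta(s_t,a_t)\big),$$ that is, the partial derivative of the energy distance with respect to the mean of $Z_\theta(s_t,a_t)$, with its standard deviation and the target held fixed. Then, with the mean $Q_{\theta_1}(s_t,a_t)$ and the target held fixed, $$\lim_{\sigma_{\theta_2}(s_t,a_t)\to\infty}\Psi_\theta(s_t,a_t)=0 .$$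
   Context: For real random variables (or laws) $U,V$ with cumulative distribution functions $F_U,F_V$, the energy distance (squared $L_2$ Cramér distance) is $d_e(U,V)=\int_{-\infty}^{\infty}(F_U(x)-F_V(x))^2\,dx$. Setting: in a Markov decision process with states $\mathcal S$, actions $\mathcal A$, real-valued reward $r$, discount factor $\gamma\in(0,1)$, entropy coefficient $\alpha$ and stochastic policy $\pi$, the critic assigns to each pair $(s,a)$ a Gaussian distribution $Z_\theta(s,a)$ with mean $Q_{\theta_1}(s,a)$ and standard deviation $\sigma_{\theta_2}(s,a)$. The target network $Z=Z_{\bar\theta}$ is of the same Gaussian form with frozen parameters $\bar\theta$. For a transition $(s_t,a_t,r_t,s_{t+1})$ and a sampled action $a_{t+1}\sim\pi(\cdot\mid s_{t+1})$, the empirical target is $$\hat{\mathcal T}_H^{\pi}Z(s_t,a_t)=r(s_t,a_t)+\gamma\big(Z(s_{t+1},a_{t+1})-\alpha\log\pi(a_{t+1}\mid s_{t+1})\big),$$ which is thus a Gaussian distribution with some mean $Q'\in\mathbb R$ and standard deviation $\sigma'$, not depending on $\theta$ (for terminal states $\sigma'$ is set to $0$, i.e. the target is a point mass). The weight $\Psi_\theta$ is the factor appearing in the mini-batch gradient of the critic loss: over a mini-batch $\hat{\mathcal B}$ of transitions, $\hat\nabla_{\theta_1}J_Z(\theta)=\frac1{|\hat{\mathcal B}|}\sum_{\hat{\mathcal B}}\Psi_\theta(s_t,a_t)\nabla_{\theta_1}Q_{\theta_1}(s_t,a_t)$, where $\hat\nabla_\theta J_Z(\theta)=\frac1{|\hat{\mathcal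 B}|}\sum_{\hat{\mathcal B}}\nabla_\theta d_e(\hat{\mathcal T}_H^{\pi}Z(s_t,a_t),Z_\theta(s_t,a_t))$. *)

theory Defs
  imports "HOL-Probability.Probability"
begin

(* The integral is finite for laws with finite first moment, in particular for all Gaussian laws and
   point masses; a divergent integral would be 0 by convention. *)
definition energy_dist :: "real measure \<Rightarrow> real measure \<Rightarrow> real" where
  "energy_dist M N = (\<integral>x. (cdf M x - cdf N x)\<^sup>2 \<partial>lborel)"

(* The second parameter is the standard deviation; standard deviation 0 means a point mass
   (normal_density m 0 is not a density). *)
definition gaussian_law :: "real \<Rightarrow> real \<Rightarrow> real measure" where
  "gaussian_law m s =
     (if s = 0 then return borel m
      else density lborel (\<lambda>x. ennreal (normal_density m s x)))"

(* pi s a is the density of the policy at state s with respect to a reference measure A on the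
   actions, e.g. count_space UNIV for discrete and lborel for continuous actions. *)
definition stochastic_policy :: "'a measure \<Rightarrow> ('s \<Rightarrow> 'a \<Rightarrow> real) \<Rightarrow> bool" where
  "stochastic_policy A \<pi> \<longleftrightarrow>
     (\<forall>s. \<pi> s \<in> borel_measurable A \<and> (\<forall>a\<in>space A. 0 \<le> \<pi> s a) \<and>
          prob_space (density A (\<lambda>a. ennreal (\<pi> s a))))"

(* Qbar and sdbar are the mean and standard deviation of the frozen target network; the standard
   deviation is set to 0 when the next state s' is terminal.  The arguments s a s' a' are the
   transition and the sampled next action. *)
definition soft_bellman_target ::
  "('s \<Rightarrow> 'a \<Rightarrow> real) \<Rightarrow> real \<Rightarrow> real \<Rightarrow> ('s \<Rightarrow> 'a \<Rightarrow> real) \<Rightarrow> 's set \<Rightarrow>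
   ('s \<Rightarrow> 'a \<Rightarrow> real) \<Rightarrow> ('s \<Rightarrow> 'a \<Rightarrow> real) \<Rightarrow> 's \<Rightarrow> 'a \<Rightarrow> 's \<Rightarrow> 'a \<Rightarrow> real measure" where
  "soft_bellman_target reward \<gamma> \<alpha> \<pi> terminal Qbar sdbar s a s' a' =
     distr (gaussian_law (Qbar s' a') (if s' \<in> terminal then 0 else sdbar s' a')) borel
       (\<lambda>z. reward s a + \<gamma> * (z - \<alpha> * ln (\<pi> s' a')))"

(* Meaningful only where the derivative exists; deriv is unspecified elsewhere. *)
definition gradient_weight :: "real measure \<Rightarrow> real \<Rightarrow> real \<Rightarrow> real" where
  "gradient_weight T q \<sigma> = deriv (\<lambda>m. energy_dist T (gaussian_law m \<sigma>)) q"

end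

theory Submission imports Defs begin

text \<open>
  Differentiating under the integral gives
  \<open>\<Psi> = 2 \<integral> (F\<^sub>T x - F\<^sub>N x) \<phi> x dx\<close>, where \<open>\<phi>\<close> and \<open>F\<^sub>N\<close> are density and distribution function of
  the normal law with mean \<open>q\<close> and standard deviation \<open>\<sigma>\<close>. The substitution \<open>x = q + \<sigma> z\<close> turns this into
  \<open>2 \<integral> (F\<^sub>T (q + \<sigma> z) - \<Phi> z) \<phi>\<^sub>0 z dz\<close> with the standard normal \<open>\<phi>\<^sub>0\<close>, \<open>\<Phi>\<close>. As \<open>\<sigma>\<close> tends to infinity,
  \<open>F\<^sub>T (q + \<sigma> z)\<close> tends to the Heaviside function, and the limiting integrand is odd.
  The only properties of the target law that matter are that it is a probability law with finite
  first moment.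
\<close>

section \<open>Differentiation under the integral sign\<close>

text \<open>On the convex set \<open>S\<close> the mean value inequality bounds every difference
  quotient by \<open>w x\<close>, so dominated convergence moves the limit inside the
  integral.\<close>

lemma has_real_derivative_lebesgue_integral:
  fixes f f' :: "real \<Rightarrow> 'a \<Rightarrow> real"
  assumes S: "open S" "convex S" "q \<in> S"
    and f_int: "\<And>m. m \<in> S \<Longrightarrow> integrable M (f m)"
    and deriv: "\<And>m x. m \<in> S \<Longrightarrow> ((\<lambda>m. f m x) has_real_derivative f' m x) (at m)"
    and bound: "\<And>m x. m \<in> S \<Longrightarrow> \<bar>f' m x\<bar> \<le> w x"
    and w: "integrable M w"
    and f'_meas: "f' q \<in> borel_measurable M"
  shows "((\<lambda>m. \<integral>x. f m x \<partial>M) has_real_derivative (\<integral>x. f' q x \<partial>M)) (at q)"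
proof -
  \<comment> \<open>The limit is taken within \<open>S\<close>, so that sequences approaching
    \<open>q\<close> stay where \<open>bound\<close> holds; openness of \<open>S\<close> makes this
    the full limit in the end.\<close>
  have "((\<lambda>m. ((\<integral>x. f m x \<partial>M) - (\<integral>x. f q x \<partial>M)) / (m - q)) \<longlongrightarrow> (\<integral>x. f' q x \<partial>M)) (at q within S)"
    unfolding tendsto_at_iff_sequentially
  proof (intro allI impI)
    fix X :: "nat \<Rightarrow> real"
    assume X: "\<forall>i. X i \<in> S - {q}" and lim: "X \<longlonglongrightarrow> q"
    have X_int: "integrable M (f (X i))" for i
      using X by (intro f_int) auto
    have "(\<lambda>i. \<integral>x. (f (X i) x - f q x) / (X i - q) \<partial>M) \<longlonglongrightarrow> (\<integral>x. f' q x \<partial>M)"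
    proof (rule integral_dominated_convergence[where w = w])
      show "AE x in M. (\<lambda>i. (f (X i) x - f q x) / (X i - q)) \<longlonglongrightarrow> f' q x"
      proof (rule AE_I2)
        fix x
        have "((\<lambda>m. (f m x - f q x) / (m - q)) \<longlongrightarrow> f' q x) (at q)"
          using deriv[OF S(3)] unfolding has_field_derivative_iff .
        then show "(\<lambda>i. (f (X i) x - f q x) / (X i - q)) \<longlonglongrightarrow> f' q x"
          using X lim unfolding tendsto_at_iff_sequentially comp_def by blast
      qed
      show "AE x in M. norm ((f (X i) x - f q x) / (X i - q)) \<le> w x" for i
      proof (rule AE_I2)
        fix x
        have "norm (f (X i) x - f q x) \<le> w x * norm (X i - q)"
          by (rule field_differentiable_bound[OF S(2), where f' = "\<lambda>m. f' m x"])
             (use X S deriv bound in \<open>auto intro: has_field_derivative_at_within\<close>)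
        then show "norm ((f (X i) x - f q x) / (X i - q)) \<le> w x"
          using X by (simp add: divide_le_eq)
      qed
      show "(\<lambda>x. (f (X i) x - f q x) / (X i - q)) \<in> borel_measurable M" for i
        using X_int[of i] f_int[OF S(3)] by auto
    qed (fact f'_meas w)+
    moreover have "(\<integral>x. (f (X i) x - f q x) / (X i - q) \<partial>M) =
        ((\<integral>x. f (X i) x \<partial>M) - (\<integral>x. f q x \<partial>M)) / (X i - q)" for i
      by (simp only: integral_divide_zero Bochner_Integration.integral_diff X_int f_int S)
    ultimately show "((\<lambda>m. ((\<integral>x. f m x \<partial>M) - (\<integral>x. f q x \<partial>M)) / (m - q)) \<circ> X) \<longlonglongrightarrow> (\<integral>x. f' q x \<partial>M)"
      by (simp only: comp_def)
  qed
  then show ?thesis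
    unfolding has_field_derivative_iff at_within_open[OF S(3,1)] .
qed

section \<open>Gaussian laws\<close>

lemma real_distribution_gaussian_law:
  assumes "0 \<le> s"
  shows "real_distribution (gaussian_law m s)"
proof (cases "s = 0")
  case True
  then show ?thesis
    by (simp add: gaussian_law_def real_distribution_def real_distribution_axioms_def
        prob_space_return)
next
  case False
  then show ?thesis
    using assms prob_space_normal_density[of s m]
    by (simp add: gaussian_law_def real_distribution_def real_distribution_axioms_def)
qed

lemma integrable_gaussian_law_id:
  assumes "0 \<le> s"
  shows "integrable (gaussian_law m s) (\<lambda>x. x)"
proof (cases "s = 0")
  case True
  then show ?thesis
    by (simp add: gaussian_law_def integrable_iff_bounded nn_integral_return)
next
  case False
  then show ?thesis
    using assms integrable_normal_moment_nz_1[of s m]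
    by (simp add: gaussian_law_def integrable_density)
qed

lemma cdf_gaussian_law:
  assumes "0 < s"
  shows "cdf (gaussian_law m s) x = (\<integral>y. indicator {..x} y * normal_density m s y \<partial>lborel)"
proof -
  have int: "integrable lborel (\<lambda>y. indicator {..x} y * normal_density m s y)"
    using integrable_real_mult_indicator[of "{..x}" lborel "normal_density m s"] assms by (simp add: mult.commute)
  have "emeasure (gaussian_law m s) {..x} = (\<integral>\<^sup>+y. ennreal (indicator {..x} y * normal_density m s y) \<partial>lborel)"
    using assms by (auto simp: gaussian_law_def emeasure_density intro!: nn_integral_cong split: split_indicator)
  also have "\<dots> = ennreal (\<integral>y. indicator {..x} y * normal_density m s y \<partial>lborel)"
    by (rule nn_integral_eq_integral[OF int]) simp
  finally show ?thesis
    by (simp add: cdf_def measure_def integral_nonneg_AE)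
qed

lemma normal_density_affine_std:
  assumes "0 < s"
  shows "s * normal_density m s (m + s * z) = std_normal_density z"
  using assms by (simp add: normal_density_def real_sqrt_mult power_mult_distrib)

text \<open>The substitution \<open>y = m + s * z\<close> reduces every normal distribution function
  to the standard one, so the mean enters only through the argument and the chain rule
  applies.\<close>

lemma cdf_gaussian_law_std:
  assumes "0 < s"
  shows "cdf (gaussian_law m s) x = cdf (gaussian_law 0 1) ((x - m) / s)"
proof -
  have "(\<integral>y. indicator {..x} y * normal_density m s y \<partial>lborel) =
      (\<integral>z. s * (indicator {..x} (m + s * z) * normal_density m s (m + s * z)) \<partial>lborel)"
    using assms by (subst lborel_integral_real_affine[where c = s and t = m]) simp_all
  also have "\<dots> = (\<integral>z. indicator {..(x - m) / s} z * std_normal_density z \<partial>lborel)"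
  proof (intro Bochner_Integration.integral_cong refl)
    fix z
    have "indicator {..x} (m + s * z) = (indicator {..(x - m) / s} z :: real)"
      using assms by (auto simp: field_simps split: split_indicator)
    then show "s * (indicator {..x} (m + s * z) * normal_density m s (m + s * z)) =
        indicator {..(x - m) / s} z * std_normal_density z"
      by (simp flip: normal_density_affine_std[OF assms, of m])
  qed
  finally show ?thesis
    using assms by (simp add: cdf_gaussian_law)
qed

text \<open>The density is even, so reflection carries the mass of \<open>{..- z}\<close> to
  \<open>{z..}\<close>, which together with \<open>{..z}\<close> covers the line.\<close>

lemma std_normal_cdf_minus:
  "cdf (gaussian_law 0 1) (- z) = 1 - cdf (gaussian_law 0 1) z"
proof -
  have int: "integrable lborel (\<lambda>y. indicator A y * std_normal_density y)"
    if "A \<in> sets borel" for A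
    using integrable_real_mult_indicator[of A lborel std_normal_density] that by (simp add: mult.commute)
  have "cdf (gaussian_law 0 1) (- z) = (\<integral>y. indicator {..- z} y * std_normal_density y \<partial>lborel)"
    by (simp add: cdf_gaussian_law)
  also have "\<dots> = (\<integral>y. indicator {..- z} (- y) * std_normal_density (- y) \<partial>lborel)"
    by (subst lborel_integral_real_affine[where c = "-1" and t = 0]) simp_all
  also have "\<dots> = (\<integral>y. indicator {z..} y * std_normal_density y \<partial>lborel)"
    by (intro Bochner_Integration.integral_cong)
      (auto simp: normal_density_def split: split_indicator)
  finally have "cdf (gaussian_law 0 1) (- z) + cdf (gaussian_law 0 1) z =
     (\<integral>y. indicator {z..} y * std_normal_density y + indicator {..z} y * std_normal_density y \<partial>lborel)"
    by (simp add: cdf_gaussian_law Bochner_Integration.integral_add int)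
  \<comment> \<open>The two half-lines overlap only in the null set \<open>{z}\<close>.\<close>
  also have "\<dots> = (\<integral>y. std_normal_density y \<partial>lborel)"
    by (rule integral_cong_AE)
      (use AE_lborel_singleton[of z] in \<open>auto split: split_indicator elim!: eventually_mono\<close>)
  finally show ?thesis
    by simp
qed

text \<open>The fundamental theorem of calculus needs a compact interval; the mass to the left of
  \<open>x - 1\<close> is split off as a constant, and \<open>x\<close> is interior to
  \<open>{x - 1..x + 1}\<close>.\<close>

lemma std_normal_cdf_has_derivative:
  "(cdf (gaussian_law 0 1) has_real_derivative std_normal_density x) (at x)"
proof -
  let ?G = "cdf (gaussian_law 0 1)" and ?a = "x - 1" and ?b = "x + 1"
  have cont: "continuous_on T std_normal_density" for T
    unfolding normal_density_def by (intro continuous_intros) auto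
  have ind_int: "integrable lborel (\<lambda>y. indicator A y * std_normal_density y)"
    if "A \<in> sets borel" for A
    using integrable_real_mult_indicator[of A lborel std_normal_density] that by (simp add: mult.commute)
  have G_eq: "?G u = ?G ?a + integral {?a..u} std_normal_density" if "u \<in> {?a..?b}" for u
  proof -
    have "?G u - ?G ?a =
        (\<integral>y. indicator {..u} y * std_normal_density y - indicator {..?a} y * std_normal_density y \<partial>lborel)"
      by (simp add: cdf_gaussian_law Bochner_Integration.integral_diff ind_int)
    \<comment> \<open>The difference of indicators is that of the half-open interval, so only the
      null set \<open>{?a}\<close> is added.\<close>
    also have "\<dots> = (\<integral>y. indicator {?a..u} y * std_normal_density y \<partial>lborel)"
      by (rule integral_cong_AE)
        (use that AE_lborel_singleton[of ?a] in \<open>auto split: split_indicator elim!: eventually_mono\<close>)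
    also have "\<dots> = integral {?a..u} std_normal_density"
      using set_borel_integral_eq_integral(2)[of "{?a..u}" std_normal_density] ind_int[of "{?a..u}"]
      by (simp add: set_integrable_def set_lebesgue_integral_def)
    finally show ?thesis
      by simp
  qed
  have "((\<lambda>u. ?G ?a + integral {?a..u} std_normal_density) has_real_derivative std_normal_density x)
      (at x within {?a..?b})"
    using DERIV_add[OF DERIV_const integral_has_real_derivative[OF cont]] by simp
  then have "(?G has_real_derivative std_normal_density x) (at x within {?a..?b})"
    by (rule has_field_derivative_transform_within[where d = 1, OF _ _ _ G_eq[symmetric]]) simp_all
  then show ?thesis
    using at_within_Icc_at[of ?a x ?b] by simp
qed

lemma gaussian_cdf_has_derivative_mean:
  assumes "0 < s"
  shows "((\<lambda>m. cdf (gaussian_law m s) x) has_real_derivative - normal_density m s x) (at m)"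
proof -
  have "((\<lambda>m. cdf (gaussian_law 0 1) ((x - m) / s)) has_real_derivative
      std_normal_density ((x - m) / s) * (- 1 / s)) (at m)"
    by (rule DERIV_chain2[OF std_normal_cdf_has_derivative])
      (use assms in \<open>auto intro!: derivative_eq_intros\<close>)
  moreover have "std_normal_density ((x - m) / s) = s * normal_density m s x"
    using normal_density_affine_std[OF assms, of m "(x - m) / s"] assms by simp
  ultimately show ?thesis
    using assms by (simp add: cdf_gaussian_law_std[OF assms])
qed

text \<open>Supplies one integrable majorant for all means within distance 1 of \<open>q\<close>.
  Doubling the variance absorbs the shift of the mean; \<open>sqrt 2\<close> corrects the
  normalisation.\<close>

lemma normal_density_le_wider:
  assumes "0 < s" and "\<bar>m - q\<bar> \<le> 1"
  shows "normal_density m s x \<le> sqrt 2 * exp (1 / (2 * s\<^sup>2)) * normal_density q (sqrt 2 * s) x"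
proof -
  have "(m - q)\<^sup>2 \<le> 1"
    using assms(2) by (simp add: abs_square_le_1)
  \<comment> \<open>This is \<open>(u + v)\<^sup>2 \<le> 2 * u\<^sup>2 + 2 * v\<^sup>2\<close> for
    \<open>u = x - m\<close> and \<open>v = m - q\<close>. Dividing by \<open>4 * s\<^sup>2\<close>
    later leaves the exponent \<open>1 / (2 * s\<^sup>2)\<close>.\<close>
  moreover have "(x - q)\<^sup>2 \<le> 2 * (x - m)\<^sup>2 + 2 * (m - q)\<^sup>2"
    using zero_le_power2[of "(x - m) - (m - q)"] by (simp add: power2_eq_square algebra_simps)
  ultimately have "(x - q)\<^sup>2 \<le> 2 * (x - m)\<^sup>2 + 2"
    by linarith
  then have "- (x - m)\<^sup>2 / (2 * s\<^sup>2) \<le> 1 / (2 * s\<^sup>2) + - (x - q)\<^sup>2 / (2 * (sqrt 2 * s)\<^sup>2)"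
    using assms by (simp add: divide_simps power_mult_distrib)
  then have "exp (- (x - m)\<^sup>2 / (2 * s\<^sup>2)) \<le>
      exp (1 / (2 * s\<^sup>2)) * exp (- (x - q)\<^sup>2 / (2 * (sqrt 2 * s)\<^sup>2))"
    by (simp flip: exp_add)
  then have le: "exp (- (x - m)\<^sup>2 / (2 * s\<^sup>2)) / (sqrt (2 * pi) * s) \<le>
      (exp (1 / (2 * s\<^sup>2)) * exp (- (x - q)\<^sup>2 / (2 * (sqrt 2 * s)\<^sup>2))) / (sqrt (2 * pi) * s)"
    using assms by (intro divide_right_mono) auto
  have wide: "sqrt 2 * normal_density q (sqrt 2 * s) x =
      exp (- (x - q)\<^sup>2 / (2 * (sqrt 2 * s)\<^sup>2)) / (sqrt (2 * pi) * s)"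
    using assms by (simp add: normal_density_def real_sqrt_mult)
  have narrow: "normal_density m s x = exp (- (x - m)\<^sup>2 / (2 * s\<^sup>2)) / (sqrt (2 * pi) * s)"
    using assms by (simp add: normal_density_def real_sqrt_mult)
  have "sqrt 2 * exp (1 / (2 * s\<^sup>2)) * normal_density q (sqrt 2 * s) x =
      exp (1 / (2 * s\<^sup>2)) * (sqrt 2 * normal_density q (sqrt 2 * s) x)"
    by (simp only: mult.commute[of "sqrt 2"] mult.assoc)
  with le show ?thesis
    unfolding narrow wide by simp
qed

section \<open>The energy distance of laws with finite first moment\<close>

lemma (in real_distribution) cdf_measurable [measurable]: "cdf M \<in> borel_measurable borel"
  by (rule borel_measurable_mono) (simp add: mono_def cdf_nondecreasing)

text \<open>The deviation from the Heaviside function at \<open>x\<close> is the mass of a half-line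
  whose points have modulus at least \<open>\<bar>x\<bar>\<close>; Markov's inequality for
  \<open>1 + \<bar>y\<bar>\<close> bounds it.\<close>

lemma (in real_distribution) cdf_tail_bound:
  assumes "integrable M (\<lambda>x. x)"
  shows "\<bar>cdf M x - indicator {0..} x\<bar> * (1 + \<bar>x\<bar>) \<le> (\<integral>y. 1 + \<bar>y\<bar> \<partial>M)"
proof -
  have markov: "prob A * (1 + \<bar>x\<bar>) \<le> (\<integral>y. 1 + \<bar>y\<bar> \<partial>M)"
    if "A \<in> sets borel" and "\<And>y. y \<in> A \<Longrightarrow> \<bar>x\<bar> \<le> \<bar>y\<bar>" for A
  proof -
    have "integrable M (indicat_real A)"
      using that by (intro integrable_real_indicator) (auto simp: less_top[symmetric])
    then have "(\<integral>y. indicator A y * (1 + \<bar>x\<bar>) \<partial>M) \<le> (\<integral>y. 1 + \<bar>y\<bar> \<partial>M)"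
      using assms that by (intro integral_mono) (auto split: split_indicator)
    then show ?thesis
      using that by (simp only: integral_mult_left_zero) simp
  qed
  show ?thesis
  proof (cases "0 \<le> x")
    case True
    have "cdf M x = 1 - prob {x<..}"
      using prob_compl[of "{x<..}"] by (simp add: cdf_def Compl_greaterThan flip: Compl_eq_Diff_UNIV)
    then show ?thesis
      using markov[of "{x<..}"] True by auto
  next
    case False
    then show ?thesis
      using markov[of "{..x}"] by (auto simp: cdf_def)
  qed
qed

text \<open>Both distribution functions are within \<open>O(1 / (1 + \<bar>x\<bar>))\<close> of the
  same Heaviside function, so the squared difference is dominated by a multiple of the Cauchy
  density.\<close>

lemma integrable_energy_dist:
  assumes "real_distribution M" "integrable M (\<lambda>x. x)"
    and "real_distribution N" "integrable N (\<lambda>x. x)"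
  shows "integrable lborel (\<lambda>x. (cdf M x - cdf N x)\<^sup>2)"
proof -
  interpret M: real_distribution M by fact
  interpret N: real_distribution N by fact
  define C where "C = (\<integral>y. 1 + \<bar>y\<bar> \<partial>M) + (\<integral>y. 1 + \<bar>y\<bar> \<partial>N)"
  have "integrable lborel (\<lambda>x::real. inverse (1 + x\<^sup>2))"
    using integrable_inverse_1_plus_square by (simp add: set_integrable_def)
  then have "integrable lborel (\<lambda>x::real. C\<^sup>2 * inverse (1 + x\<^sup>2))"
    by simp
  then show ?thesis
  proof (rule Bochner_Integration.integrable_bound)
    show "AE x in lborel. norm ((cdf M x - cdf N x)\<^sup>2) \<le> norm (C\<^sup>2 * inverse (1 + x\<^sup>2))"
    proof (rule AE_I2)
      fix x :: real
      have "\<bar>cdf M x - cdf N x\<bar> * (1 + \<bar>x\<bar>) \<le>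
          (\<bar>cdf M x - indicator {0..} x\<bar> + \<bar>cdf N x - indicator {0..} x\<bar>) * (1 + \<bar>x\<bar>)"
        by (intro mult_right_mono) auto
      also have "\<dots> \<le> C"
        using M.cdf_tail_bound[OF assms(2), of x] N.cdf_tail_bound[OF assms(4), of x]
        by (simp add: C_def distrib_right)
      finally have "(\<bar>cdf M x - cdf N x\<bar> * (1 + \<bar>x\<bar>))\<^sup>2 \<le> C\<^sup>2"
        by (intro power_mono) auto
      moreover have "(cdf M x - cdf N x)\<^sup>2 * (1 + x\<^sup>2) \<le> (cdf M x - cdf N x)\<^sup>2 * (1 + \<bar>x\<bar>)\<^sup>2"
        by (intro mult_left_mono) (auto simp: power2_sum)
      ultimately have "(cdf M x - cdf N x)\<^sup>2 * (1 + x\<^sup>2) \<le> C\<^sup>2"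
        by (simp add: power_mult_distrib)
      moreover have "0 < 1 + x\<^sup>2"
        by (simp add: add_pos_nonneg)
      ultimately show "norm ((cdf M x - cdf N x)\<^sup>2) \<le> norm (C\<^sup>2 * inverse (1 + x\<^sup>2))"
        by (simp add: field_simps)
    qed
  qed measurable
qed

text \<open>Raising the mean lowers the Gaussian distribution function at rate
  \<open>normal_density\<close>, hence the positive sign. Since two distribution functions differ by
  at most 1, the wider normal density dominates the derivative near \<open>q\<close>.\<close>

lemma energy_dist_has_derivative_mean:
  assumes "real_distribution T" "integrable T (\<lambda>x. x)" and s: "0 < s"
  shows "((\<lambda>m. energy_dist T (gaussian_law m s)) has_real_derivative
      (\<integral>x. 2 * (cdf T x - cdf (gaussian_law q s) x) * normal_density q s x \<partial>lborel)) (at q)"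
  unfolding energy_dist_def
proof (rule has_real_derivative_lebesgue_integral[where S = "{q - 1<..<q + 1}" and
      w = "\<lambda>x. 2 * (sqrt 2 * exp (1 / (2 * s\<^sup>2)) * normal_density q (sqrt 2 * s) x)" and
      f' = "\<lambda>m x. 2 * (cdf T x - cdf (gaussian_law m s) x) * normal_density m s x"])
  interpret T: real_distribution T by fact
  interpret N: real_distribution "gaussian_law m s" for m
    using s by (simp add: real_distribution_gaussian_law)
  show "integrable lborel (\<lambda>x. (cdf T x - cdf (gaussian_law m s) x)\<^sup>2)" for m
    using s by (intro integrable_energy_dist assms(1,2) N.real_distribution_axioms
        integrable_gaussian_law_id) simp
  show "((\<lambda>m. (cdf T x - cdf (gaussian_law m s) x)\<^sup>2) has_real_derivative
      2 * (cdf T x - cdf (gaussian_law m s) x) * normal_density m s x) (at m)" for m x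
  proof -
    have "((\<lambda>m. cdf T x - cdf (gaussian_law m s) x) has_real_derivative normal_density m s x) (at m)"
      using DERIV_diff[OF DERIV_const gaussian_cdf_has_derivative_mean[OF s]] by simp
    from DERIV_power[OF this, of 2] show ?thesis
      by (simp add: mult_ac del: right_diff_distrib_numeral)
  qed
  show "\<bar>2 * (cdf T x - cdf (gaussian_law m s) x) * normal_density m s x\<bar> \<le>
      2 * (sqrt 2 * exp (1 / (2 * s\<^sup>2)) * normal_density q (sqrt 2 * s) x)"
    if "m \<in> {q - 1<..<q + 1}" for m x
  proof -
    have "\<bar>cdf T x - cdf (gaussian_law m s) x\<bar> \<le> 1"
      using T.cdf_nonneg[of x] T.cdf_bounded_prob[of x] N.cdf_nonneg[of m x] N.cdf_bounded_prob[of m x]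
      by linarith
    then have "\<bar>cdf T x - cdf (gaussian_law m s) x\<bar> * normal_density m s x \<le> 1 * normal_density m s x"
      by (intro mult_right_mono) auto
    also have "\<dots> \<le> sqrt 2 * exp (1 / (2 * s\<^sup>2)) * normal_density q (sqrt 2 * s) x"
      using normal_density_le_wider[OF s, of m q x] that by auto
    finally show ?thesis
      by (simp add: abs_mult mult.assoc del: right_diff_distrib_numeral)
  qed
  show "integrable lborel (\<lambda>x. 2 * (sqrt 2 * exp (1 / (2 * s\<^sup>2)) * normal_density q (sqrt 2 * s) x))"
    using s by simp
  show "(\<lambda>x. 2 * (cdf T x - cdf (gaussian_law q s) x) * normal_density q s x) \<in> borel_measurable lborel"
    by measurable
qed simp_all

section \<open>The gradient weight and its limit for large standard deviation\<close>

text \<open>Standardising by \<open>x = q + s * z\<close> leaves \<open>s\<close> only in the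
  argument of \<open>cdf T\<close>, which prepares the passage to the limit.\<close>

lemma gradient_weight_eq:
  assumes "real_distribution T" "integrable T (\<lambda>x. x)" "0 < s"
  shows "gradient_weight T q s =
      (\<integral>z. 2 * (cdf T (q + s * z) - cdf (gaussian_law 0 1) z) * std_normal_density z \<partial>lborel)"
proof -
  have "gradient_weight T q s =
      (\<integral>x. 2 * (cdf T x - cdf (gaussian_law q s) x) * normal_density q s x \<partial>lborel)"
    unfolding gradient_weight_def by (rule DERIV_imp_deriv[OF energy_dist_has_derivative_mean[OF assms]])
  also have "\<dots> = (\<integral>z. s * (2 * (cdf T (q + s * z) - cdf (gaussian_law q s) (q + s * z)) *
      normal_density q s (q + s * z)) \<partial>lborel)"
    using assms(3) by (subst lborel_integral_real_affine[where c = s and t = q]) simp_all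
  also have "\<dots> = (\<integral>z. 2 * (cdf T (q + s * z) - cdf (gaussian_law 0 1) z) * std_normal_density z \<partial>lborel)"
  proof (intro Bochner_Integration.integral_cong refl)
    fix z
    have "cdf (gaussian_law q s) (q + s * z) = cdf (gaussian_law 0 1) z"
      using assms(3) by (simp add: cdf_gaussian_law_std[of s])
    \<comment> \<open>The Jacobian \<open>s\<close> is absorbed by the density, turning it into the
      standard normal one.\<close>
    then show "s * (2 * (cdf T (q + s * z) - cdf (gaussian_law q s) (q + s * z)) * normal_density q s (q + s * z)) =
        2 * (cdf T (q + s * z) - cdf (gaussian_law 0 1) z) * std_normal_density z"
      unfolding normal_density_affine_std[OF assms(3), of q z, symmetric] by (simp only: mult_ac)
  qed
  finally show ?thesis .
qed

text \<open>Off the origin the integrand is odd, so its integral equals its own negative.\<close>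

lemma integral_heaviside_minus_std_normal_cdf:
  "(\<integral>z. 2 * (indicator {0<..} z - cdf (gaussian_law 0 1) z) * std_normal_density z \<partial>lborel) = 0"
  (is "(\<integral>z. ?g z \<partial>lborel) = 0")
proof -
  interpret N: real_distribution "gaussian_law 0 1"
    by (simp add: real_distribution_gaussian_law)
  have even: "std_normal_density (- z) = std_normal_density z" for z
    by (simp add: normal_density_def)
  have "(\<integral>z. ?g z \<partial>lborel) = (\<integral>z. ?g (- z) \<partial>lborel)"
    by (subst lborel_integral_real_affine[where c = "-1" and t = 0]) simp_all
  also have "\<dots> = (\<integral>z. - ?g z \<partial>lborel)"
  proof (rule integral_cong_AE)
    show "AE z in lborel. ?g (- z) = - ?g z"
      \<comment> \<open>At \<open>z = 0\<close> the indicator is 0 on both sides of the reflection,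
        so the complement identity fails there.\<close>
      using AE_lborel_singleton[of 0]
    proof eventually_elim
      case (elim z)
      then have flip: "indicator {0<..} (- z) = (1 - indicator {0<..} z :: real)"
        by (auto split: split_indicator)
      show ?case
        unfolding flip even std_normal_cdf_minus by (simp add: algebra_simps)
    qed
  qed measurable
  finally show ?thesis
    by simp
qed

text \<open>Dominated convergence with majorant \<open>2 * std_normal_density z\<close>: the target
  is seen at scale \<open>\<sigma>\<close> and shrinks to a unit jump at the centre of the standard
  normal law.\<close>

lemma gradient_weight_tendsto_0:
  assumes "real_distribution T" "integrable T (\<lambda>x. x)"
  shows "((\<lambda>\<sigma>. gradient_weight T q \<sigma>) \<longlongrightarrow> 0) at_top"
proof -
  interpret T: real_distribution T by fact
  interpret N: real_distribution "gaussian_law 0 1"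
    by (simp add: real_distribution_gaussian_law)
  let ?G = "cdf (gaussian_law 0 1)"
  have "((\<lambda>\<sigma>. \<integral>z. 2 * (cdf T (q + \<sigma> * z) - ?G z) * std_normal_density z \<partial>lborel) \<longlongrightarrow>
      (\<integral>z. 2 * (indicator {0<..} z - ?G z) * std_normal_density z \<partial>lborel)) at_top"
  proof (rule integral_dominated_convergence_at_top[where w = "\<lambda>z. 2 * std_normal_density z"])
    show "AE z in lborel. ((\<lambda>\<sigma>. 2 * (cdf T (q + \<sigma> * z) - ?G z) * std_normal_density z) \<longlongrightarrow>
        2 * (indicator {0<..} z - ?G z) * std_normal_density z) at_top"
      \<comment> \<open>At \<open>z = 0\<close> the value \<open>cdf T q\<close> does not depend on
        \<open>\<sigma>\<close> and may differ from the indicator.\<close>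
      using AE_lborel_singleton[of 0]
    proof eventually_elim
      case (elim z)
      have "((\<lambda>\<sigma>. cdf T (q + \<sigma> * z)) \<longlongrightarrow> indicator {0<..} z) at_top"
      proof (cases "0 < z")
        case True
        have "filterlim (\<lambda>\<sigma>. q + \<sigma> * z) at_top at_top"
          by (intro filterlim_tendsto_add_at_top[OF tendsto_const]
              filterlim_at_top_mult_tendsto_pos[OF tendsto_const True] filterlim_ident)
        from filterlim_compose[OF T.cdf_lim_at_top_prob this] True show ?thesis
          by simp
      next
        case False
        with elim have "z < 0"
          by simp
        have "filterlim (\<lambda>\<sigma>. q + \<sigma> * z) at_bot at_top"
        proof -
          have "filterlim (\<lambda>\<sigma>. - q + \<sigma> * (- z)) at_top at_top"
            by (intro filterlim_tendsto_add_at_top[OF tendsto_const]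
                filterlim_at_top_mult_tendsto_pos[OF tendsto_const _ filterlim_ident])
              (use \<open>z < 0\<close> in simp)
          then show ?thesis
            by (simp add: filterlim_uminus_at_bot)
        qed
        from filterlim_compose[OF T.cdf_lim_at_bot this] False show ?thesis
          by simp
      qed
      then show ?case
        by (intro tendsto_mult tendsto_diff tendsto_const)
    qed
    show "\<forall>\<^sub>F \<sigma> in at_top. AE z in lborel.
        norm (2 * (cdf T (q + \<sigma> * z) - ?G z) * std_normal_density z) \<le> 2 * std_normal_density z"
    proof (intro always_eventually allI AE_I2)
      fix \<sigma> z :: real
      have "\<bar>cdf T (q + \<sigma> * z) - ?G z\<bar> \<le> 1"
        using T.cdf_nonneg[of "q + \<sigma> * z"] T.cdf_bounded_prob[of "q + \<sigma> * z"]
          N.cdf_nonneg[of z] N.cdf_bounded_prob[of z] by linarith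
      then have "\<bar>cdf T (q + \<sigma> * z) - ?G z\<bar> * std_normal_density z \<le> 1 * std_normal_density z"
        by (intro mult_right_mono) auto
      then show "norm (2 * (cdf T (q + \<sigma> * z) - ?G z) * std_normal_density z) \<le> 2 * std_normal_density z"
        by (simp add: abs_mult mult.assoc del: right_diff_distrib_numeral)
    qed
    show "(\<lambda>z. 2 * (indicator {0<..} z - ?G z) * std_normal_density z) \<in> borel_measurable lborel"
      by measurable
    show "(\<lambda>z. 2 * (cdf T (q + \<sigma> * z) - ?G z) * std_normal_density z) \<in> borel_measurable lborel" for \<sigma>
      by measurable
  qed simp
  then have "((\<lambda>\<sigma>. \<integral>z. 2 * (cdf T (q + \<sigma> * z) - ?G z) * std_normal_density z \<partial>lborel) \<longlongrightarrow> 0) at_top"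
    by (simp only: integral_heaviside_minus_std_normal_cdf)
  \<comment> \<open>The integral formula is available for positive \<open>\<sigma>\<close>, which is
    enough near infinity.\<close>
  moreover have "\<forall>\<^sub>F \<sigma> in at_top. gradient_weight T q \<sigma> =
      (\<integral>z. 2 * (cdf T (q + \<sigma> * z) - ?G z) * std_normal_density z \<partial>lborel)"
    using eventually_gt_at_top[of 0] by eventually_elim (rule gradient_weight_eq[OF assms])
  ultimately show ?thesis
    by (simp only: tendsto_cong)
qed

section \<open>The soft Bellman target\<close>

text \<open>The log-policy term is constant in \<open>z\<close>, so the target is the image of a
  Gaussian law or point mass under an affine map, which preserves a finite first moment.\<close>

lemma
  assumes "s' \<notin> terminal \<Longrightarrow> 0 \<le> sdbar s' a'"
  shows real_distribution_soft_bellman_target: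
      "real_distribution (soft_bellman_target reward \<gamma> \<alpha> \<pi> terminal Qbar sdbar s a s' a')"
    and integrable_soft_bellman_target_id:
      "integrable (soft_bellman_target reward \<gamma> \<alpha> \<pi> terminal Qbar sdbar s a s' a') (\<lambda>x. x)"
proof -
  \<comment> \<open>Terminal and non-terminal next states are treated together, a point mass being
    the case \<open>sd = 0\<close>.\<close>
  define sd where "sd = (if s' \<in> terminal then 0 else sdbar s' a')"
  have sd: "0 \<le> sd"
    using assms by (simp add: sd_def)
  interpret G: real_distribution "gaussian_law (Qbar s' a') sd"
    using sd by (rule real_distribution_gaussian_law)
  let ?f = "\<lambda>z. reward s a + \<gamma> * (z - \<alpha> * ln (\<pi> s' a'))"
  have f: "?f \<in> borel_measurable (gaussian_law (Qbar s' a') sd)"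
    by measurable
  have T: "soft_bellman_target reward \<gamma> \<alpha> \<pi> terminal Qbar sdbar s a s' a' =
      distr (gaussian_law (Qbar s' a') sd) borel ?f"
    by (simp only: soft_bellman_target_def sd_def)
  show "real_distribution (soft_bellman_target reward \<gamma> \<alpha> \<pi> terminal Qbar sdbar s a s' a')"
    unfolding T using f by (rule G.real_distribution_distr)
  have "integrable (gaussian_law (Qbar s' a') sd) ?f"
    by (intro Bochner_Integration.integrable_add Bochner_Integration.integrable_diff
        integrable_mult_right integrable_gaussian_law_id[OF sd] G.integrable_const)
  then show "integrable (soft_bellman_target reward \<gamma> \<alpha> \<pi> terminal Qbar sdbar s a s' a') (\<lambda>x. x)"
    unfolding T by (simp only: integrable_distr_eq[OF f measurable_ident_sets[OF refl]])
qed

text \<open>The differentiability conjunct certifies that \<open>gradient_weight\<close>, defined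
  through \<open>deriv\<close>, is the true partial derivative for every positive
  \<open>\<sigma>\<close>, so the limit is not about an unspecified value.\<close>

theorem proposition5p3:
  fixes A :: "'a measure"
    and reward \<pi> Qbar sdbar :: "'s \<Rightarrow> 'a \<Rightarrow> real"
    and terminal :: "'s set"
    and \<gamma> \<alpha> q :: real
    and s s' :: 's and a a' :: 'a
  assumes "0 < \<gamma>" and "\<gamma> < 1"
    and "stochastic_policy A \<pi>"
    and "a \<in> space A" and "a' \<in> space A" and "0 < \<pi> s' a'"
    and "\<And>x b. b \<in> space A \<Longrightarrow> 0 < sdbar x b"
  shows "(\<forall>\<sigma>>0. (\<lambda>m. energy_dist
              (soft_bellman_target reward \<gamma> \<alpha> \<pi> terminal Qbar sdbar s a s' a')
              (gaussian_law m \<sigma>)) differentiable (at q)) \<and>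
         ((\<lambda>\<sigma>. gradient_weight
              (soft_bellman_target reward \<gamma> \<alpha> \<pi> terminal Qbar sdbar s a s' a') q \<sigma>)
            \<longlongrightarrow> 0) at_top"
proof -
  have "0 \<le> sdbar s' a'"
    using assms(5,7) by (simp add: less_imp_le)
  then have T: "real_distribution (soft_bellman_target reward \<gamma> \<alpha> \<pi> terminal Qbar sdbar s a s' a')"
      "integrable (soft_bellman_target reward \<gamma> \<alpha> \<pi> terminal Qbar sdbar s a s' a') (\<lambda>x. x)"
    by (simp_all add: real_distribution_soft_bellman_target integrable_soft_bellman_target_id)
  show ?thesis
    using energy_dist_has_derivative_mean[OF T] gradient_weight_tendsto_0[OF T]
    unfolding real_differentiable_def by blast
qed

end
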